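(* In a full relational model over a set of states $\Sigma$ (states being valuations of program variables), the following inference rules for forward simulation judgments $c\mid d:P\overset{\exists}{\approx>}Q$ are sound, i.e., whenever the premises hold, the conclusion holds (all $P,Q,R,S$ relations on $\Sigma$, $c,c',d,d'$ relations on $\Sigma$, $e,e'\subseteq\Sigma$ conditions): (eConseq) if $R\subseteq P$, $c\mid d:P\overset{\exists}{\approx>}Q$ and $Q\subseteq S$, then $c\mid d:R\overset{\exists}{\approx>}S$; (eSeq) if $c\mid c':P\overset{\exists}{\approx>}R$ and $d\mid d':R\overset{\exists}{\approx>}Q$, then $c;d\mid c';d':P\overset{\exists}{\approx>}Q$; (eIf) if every $(\sigma,\sigma')\in P$ satisfies $\sigma\in e\iff\sigma'\in e'$, $c\mid c':P\wedge\langle e]\wedge[e'\rangle\overset{\exists}{\approx>}Q$ and $d\mid d':P\wedge\neg\langle e]\wedge\neg[e'\rangle\overset{\exists}{\approx>}Q$, then $\mathsf{if}\ e\ \mathsf{then}\ c\ \mathsf{else}\ d\mid \mathsf{if}\ e'\ \mathsf{then}\ c'\ \mathsf{else}\ d':P\overset{\exists}{\approx>}Q$; (eWh) if every $(\sigma,\sigma')\in P$ satisfies $\sigma\in e\iff\sigma'\in e'$ and $c\mid c':P\wedge\langle e]\wedge[e'\rangle\overset{\exists}{\approx>}P$, then $\mathsf{while}\ e\ \mathsf{do}\ c\mid\mathsf{while}\ e'\ \mathsf{do}\ c':P\overset{\exists}{\approx>}P\wedge\neg\langle e]\wedge\neg[e'\rangle$; (eWhL) if every $(\sigma,\sigma')\in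 P$ with $\sigma'\in e'$ has $\sigma\in e$, $c\mid c':P\wedge\langle e]\wedge[e'\rangle\overset{\exists}{\approx>}P$ and $c\mid\mathsf{skip}:P\wedge\langle e]\overset{\exists}{\approx>}P$, then $\mathsf{while}\ e\ \mathsf{do}\ c\mid\mathsf{while}\ e'\ \mathsf{do}\ c':P\overset{\exists}{\approx>}P\wedge\neg\langle e]\wedge\neg[e'\rangle$; (eHav) if $1\le[\mathbf{hav}\rangle;\dot R;[\mathbf{hav}\rangle$ then $\mathbf{hav}\mid\mathbf{hav}:\mathit{true}\overset{\exists}{\approx>}R$; (enAss) for program variables $x,y$, if $1\le[y:=\mathrm{any}\rangle;\dot R;[y:=\mathrm{any}\rangle$ then $x:=\mathrm{any}\mid y:=\mathrm{any}:\mathit{true}\overset{\exists}{\approx>}R$; (eDisj) if $c\mid d:P\overset{\exists}{\approx>}Q$ and $c\mid d:R\overset{\exists}{\approx>}Q$ then $c\mid d:P\vee R\overset{\exists}{\approx>}Q$.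
   Context: $\Sigma$ is the set of states (functions from program variables to values). The full relational model has as actions all relations on $\Sigma$ and as tests all sub-identities; the corresponding full relational BiKAT has all relations on $\Sigma\times\Sigma$ as elements and all sub-identities of $\Sigma\times\Sigma$ as bitests; $1$ is the identity, $;$ composition, $\le$ inclusion. The forward simulation judgment $c\mid d:P\overset{\exists}{\approx>}Q$ means $\forall\sigma,\sigma',\tau.\ \sigma P\sigma'\wedge \sigma\,c\,\tau\Rightarrow\exists\tau'.\ \sigma'\,d\,\tau'\wedge\tau Q\tau'$. A condition $e\subseteq\Sigma$ is identified with the sub-identity $\{(\sigma,\sigma):\sigma\in e\}$; $\mathsf{skip}=id_\Sigma$, $\mathsf{if}\ e\ \mathsf{then}\ c\ \mathsf{else}\ d = e;c\cup\neg e;d$, $\mathsf{while}\ e\ \mathsf{do}\ c=(e;c)^*;\neg e$. For a relation $P$, $P\wedge\langle e]=\{(\sigma,\sigma')\in P:\sigma\in e\}$, $P\wedge[e'\rangle=\{(\sigma,\sigma')\in P:\sigma'\in e'\}$, $\neg\langle e]$, $\neg[e'\rangle$ similarly with $\sigma\notin e$, $\sigma'\notin e'$; $\vee$ is union; $\mathit{true}=\Sigma\times\Sigma$. $\mathbf{hav}=\Sigma\times\Sigma$. $x:=\mathrm{any}$ is the relation $\{(\sigma,\sigma[x\mapsto v]):\sigma\in\Sigma, v \text{ a value}\}$. In the BiKAT, $[a\rangle=id_\Sigma\otimes a$ where $(\sigma,\sigma')(R\otimes S)(\tau,\tau')$ iff $\sigma R\tau\wedge\sigma'S\tau'$, and $\dot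 R$ is the sub-identity containing $((\sigma,\sigma'),(\sigma,\sigma'))$ iff $\sigma R\sigma'$. *)

theory Defs
  imports Main
begin

type_synonym ('var, 'val) state = "'var \<Rightarrow> 'val"

text \<open>A condition \<open>e\<close> is identified with the sub-identity \<open>Id_on e\<close>; relational composition,
  union and reflexive-transitive closure are those of the library.\<close>

definition skip :: "'s rel" where
  "skip = Id"

definition if_rel :: "'s set \<Rightarrow> 's rel \<Rightarrow> 's rel \<Rightarrow> 's rel" where
  "if_rel e c d = Id_on e O c \<union> Id_on (- e) O d"

definition while_rel :: "'s set \<Rightarrow> 's rel \<Rightarrow> 's rel" where
  "while_rel e c = (Id_on e O c)\<^sup>* O Id_on (- e)"

definition hav :: "'s rel" where
  "hav = UNIV"

definition assign_any :: "'var \<Rightarrow> ('var, 'val) state rel" where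
  "assign_any x = {(\<sigma>, \<sigma>(x := v)) | \<sigma> v. True}"

definition fsim :: "'s rel \<Rightarrow> 's rel \<Rightarrow> 's rel \<Rightarrow> 's rel \<Rightarrow> bool" where
  "fsim c d P Q \<longleftrightarrow>
     (\<forall>\<sigma> \<sigma>' \<tau>. (\<sigma>, \<sigma>') \<in> P \<and> (\<sigma>, \<tau>) \<in> c \<longrightarrow> (\<exists>\<tau>'. (\<sigma>', \<tau>') \<in> d \<and> (\<tau>, \<tau>') \<in> Q))"

text \<open>The relations \<open>\<langle>e]\<close> and \<open>[e\<rangle>\<close> on states.\<close>

definition left_cond :: "'s set \<Rightarrow> 's rel" where
  "left_cond e = {(\<sigma>, \<sigma>'). \<sigma> \<in> e}"

definition right_cond :: "'s set \<Rightarrow> 's rel" where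
  "right_cond e = {(\<sigma>, \<sigma>'). \<sigma>' \<in> e}"

text \<open>The full relational BiKAT has the relations on pairs of states as elements: \<open>tensor R S\<close>
  is \<open>R \<otimes> S\<close>, \<open>right_embed a\<close> is \<open>[a\<rangle>\<close>, and \<open>bitest R\<close> is the dotted \<open>R\<close>.\<close>

definition tensor :: "'s rel \<Rightarrow> 's rel \<Rightarrow> ('s \<times> 's) rel" where
  "tensor R S = {((\<sigma>, \<sigma>'), (\<tau>, \<tau>')). (\<sigma>, \<tau>) \<in> R \<and> (\<sigma>', \<tau>') \<in> S}"

definition right_embed :: "'s rel \<Rightarrow> ('s \<times> 's) rel" where
  "right_embed a = tensor Id a"

definition bitest :: "'s rel \<Rightarrow> ('s \<times> 's) rel" where
  "bitest R = Id_on R"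

end

theory Submission imports Defs begin

text \<open>A forward simulation says that each left run from related states is answered by some
  right run ending in related states. Such answers can be chained, weakened and chosen by cases. For
  loops, \<open>P\<close> is the invariant: \<open>fsim_rtrancl\<close> lifts the answer to one
  iteration to whole runs by induction on the left run, and \<open>fsim_while_rel\<close> chains
  this with the exit tests. For (eHav) and (enAss), \<open>fsim_right_embed\<close> reads the
  algebraic inequality at a single pair of states to get the answer.\<close>

lemma fsim_conseq:
  assumes "R \<subseteq> P" "fsim c d P Q" "Q \<subseteq> S"
  shows "fsim c d R S"
  using assms unfolding fsim_def by blast

lemma fsim_relcomp:
  assumes "fsim c c' P R" "fsim d d' R Q"
  shows "fsim (c O d) (c' O d') P Q"
  using assms unfolding fsim_def by (meson relcomp.simps)

text \<open>Agreement of the guards on \<open>P\<close> makes the right program enter the branch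
  chosen on the left.\<close>

lemma fsim_if_rel:
  assumes "\<forall>(\<sigma>, \<sigma>') \<in> P. \<sigma> \<in> e \<longleftrightarrow> \<sigma>' \<in> e'"
    and "fsim c c' (P \<inter> left_cond e \<inter> right_cond e') Q"
    and "fsim d d' (P \<inter> - left_cond e \<inter> - right_cond e') Q"
  shows "fsim (if_rel e c d) (if_rel e' c' d') P Q"
  using assms unfolding fsim_def if_rel_def left_cond_def right_cond_def
  by (fastforce simp: relcomp_unfold Id_on_iff)

lemma fsim_rtrancl:
  assumes "fsim c (d\<^sup>*) P P"
  shows "fsim (c\<^sup>*) (d\<^sup>*) P P"
  unfolding fsim_def
proof (intro allI impI, elim conjE)
  fix \<sigma> \<sigma>' \<tau>
  assume "(\<sigma>, \<sigma>') \<in> P" and "(\<sigma>, \<tau>) \<in> c\<^sup>*"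
  from this(2,1) show "\<exists>\<tau>'. (\<sigma>', \<tau>') \<in> d\<^sup>* \<and> (\<tau>, \<tau>') \<in> P"
  proof (induction rule: rtrancl_induct)
    case base
    then show ?case by blast
  next
    case (step \<rho> \<tau>)
    then obtain \<rho>' where "(\<sigma>', \<rho>') \<in> d\<^sup>*" "(\<rho>, \<rho>') \<in> P" by blast
    \<comment> \<open>The last \<open>c\<close> step, taken from the related pair
      (\<open>\<rho>\<close>, \<open>\<rho>'\<close>), is answered by a \<open>d\<close> path, which
      is appended to the path reaching \<open>\<rho>'\<close>.\<close>
    with step.hyps(2) assms show ?case
      unfolding fsim_def by (meson rtrancl_trans)
  qed
qed

text \<open>Letting the right-hand side answer one iteration by any number of iterations, zero
  included, covers both the lockstep rule (eWh) and the rule (eWhL) with stuttering.\<close>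

lemma fsim_while_rel:
  assumes guard: "\<forall>(\<sigma>, \<sigma>') \<in> P. \<sigma>' \<in> e' \<longrightarrow> \<sigma> \<in> e"
    and body: "fsim (Id_on e O c) ((Id_on e' O c')\<^sup>*) P P"
  shows "fsim (while_rel e c) (while_rel e' c') P (P \<inter> - left_cond e \<inter> - right_cond e')"
  unfolding while_rel_def
proof (rule fsim_relcomp[OF fsim_rtrancl[OF body]])
  \<comment> \<open>By contraposition of the guard implication, the right loop can exit whenever the
    left one does.\<close>
  show "fsim (Id_on (- e)) (Id_on (- e')) P (P \<inter> - left_cond e \<inter> - right_cond e')"
    using guard unfolding fsim_def left_cond_def right_cond_def by fastforce
qed

lemma fsim_while_rel_lockstep:
  assumes guard: "\<forall>(\<sigma>, \<sigma>') \<in> P. \<sigma> \<in> e \<longleftrightarrow> \<sigma>' \<in> e'"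
    and body: "fsim c c' (P \<inter> left_cond e \<inter> right_cond e') P"
  shows "fsim (while_rel e c) (while_rel e' c') P (P \<inter> - left_cond e \<inter> - right_cond e')"
proof (rule fsim_while_rel)
  show "\<forall>(\<sigma>, \<sigma>') \<in> P. \<sigma>' \<in> e' \<longrightarrow> \<sigma> \<in> e"
    using guard by blast
  have "fsim (Id_on e O c) (Id_on e' O c') P P"
    using guard body unfolding fsim_def left_cond_def right_cond_def
    by (fastforce simp: relcomp_unfold Id_on_iff)
  then show "fsim (Id_on e O c) ((Id_on e' O c')\<^sup>*) P P"
    unfolding fsim_def by (meson r_into_rtrancl)
qed

text \<open>The right loop answers each left iteration by standing still, that is, by the reflexive
  part of the closure.\<close>

lemma fsim_while_rel_left:
  assumes guard: "\<forall>(\<sigma>, \<sigma>') \<in> P. \<sigma>' \<in> e' \<longrightarrow> \<sigma> \<in> e"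
    and left: "fsim c skip (P \<inter> left_cond e) P"
  shows "fsim (while_rel e c) (while_rel e' c') P (P \<inter> - left_cond e \<inter> - right_cond e')"
proof (rule fsim_while_rel[OF guard])
  show "fsim (Id_on e O c) ((Id_on e' O c')\<^sup>*) P P"
    using left unfolding fsim_def left_cond_def skip_def
    by (fastforce simp: relcomp_unfold Id_on_iff)
qed

lemma fsim_right_embed:
  assumes "Id \<subseteq> right_embed d O bitest R O right_embed d"
  shows "fsim c d UNIV R"
  unfolding fsim_def
proof (intro allI impI)
  fix \<sigma> \<sigma>' \<tau>
  \<comment> \<open>The left component is the final state \<open>\<tau>\<close>, which
    \<open>right_embed\<close> keeps fixed. The first factor moves \<open>\<sigma>'\<close> along
    \<open>d\<close> to the required \<open>\<tau>'\<close>, and the bitest puts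
    (\<open>\<tau>\<close>, \<open>\<tau>'\<close>) in \<open>R\<close>.\<close>
  have "((\<tau>, \<sigma>'), (\<tau>, \<sigma>')) \<in> right_embed d O bitest R O right_embed d"
    using assms by blast
  then show "\<exists>\<tau>'. (\<sigma>', \<tau>') \<in> d \<and> (\<tau>, \<tau>') \<in> R"
    unfolding right_embed_def tensor_def bitest_def by auto
qed

lemma fsim_Un:
  assumes "fsim c d P Q" "fsim c d R Q"
  shows "fsim c d (P \<union> R) Q"
  using assms unfolding fsim_def by blast

theorem theorem7p8:
  fixes P Q R S c c' d d' :: "('var, 'val) state rel"
    and e e' :: "('var, 'val) state set"
    and x y :: 'var
  shows
    "(R \<subseteq> P \<and> fsim c d P Q \<and> Q \<subseteq> S \<longrightarrow> fsim c d R S) \<and>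
     (fsim c c' P R \<and> fsim d d' R Q \<longrightarrow> fsim (c O d) (c' O d') P Q) \<and>
     ((\<forall>(\<sigma>, \<sigma>') \<in> P. \<sigma> \<in> e \<longleftrightarrow> \<sigma>' \<in> e') \<and>
        fsim c c' (P \<inter> left_cond e \<inter> right_cond e') Q \<and>
        fsim d d' (P \<inter> - left_cond e \<inter> - right_cond e') Q \<longrightarrow>
        fsim (if_rel e c d) (if_rel e' c' d') P Q) \<and>
     ((\<forall>(\<sigma>, \<sigma>') \<in> P. \<sigma> \<in> e \<longleftrightarrow> \<sigma>' \<in> e') \<and>
        fsim c c' (P \<inter> left_cond e \<inter> right_cond e') P \<longrightarrow>
        fsim (while_rel e c) (while_rel e' c') P (P \<inter> - left_cond e \<inter> - right_cond e')) \<and>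
     ((\<forall>(\<sigma>, \<sigma>') \<in> P. \<sigma>' \<in> e' \<longrightarrow> \<sigma> \<in> e) \<and>
        fsim c c' (P \<inter> left_cond e \<inter> right_cond e') P \<and>
        fsim c skip (P \<inter> left_cond e) P \<longrightarrow>
        fsim (while_rel e c) (while_rel e' c') P (P \<inter> - left_cond e \<inter> - right_cond e')) \<and>
     (Id \<subseteq> right_embed hav O bitest R O right_embed hav \<longrightarrow> fsim hav hav UNIV R) \<and>
     (Id \<subseteq> right_embed (assign_any y) O bitest R O right_embed (assign_any y) \<longrightarrow>
        fsim (assign_any x) (assign_any y) UNIV R) \<and>
     (fsim c d P Q \<and> fsim c d R Q \<longrightarrow> fsim c d (P \<union> R) Q)"
  using fsim_conseq[of R P c d Q S] fsim_relcomp[of c c' P R d d' Q]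
    fsim_if_rel[of P e e' c c' Q d d'] fsim_while_rel_lockstep[of P e e' c c']
    fsim_while_rel_left[of P e' e c c'] fsim_right_embed[of hav R hav]
    fsim_right_embed[of "assign_any y" R "assign_any x"] fsim_Un[of c d P Q R]
  by argo

end
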